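(* Let $\overline{\mathrm{Q}}$ be any imprecise probability tree. The global measure-theoretic upper expectation $\overline{\mathrm{E}}_{\mathrm{meas}}$ is an element of $\overline{\mathbb{E}}_{1-5}(\overline{\mathrm{Q}})$, i.e. it satisfies P1–P5.
   Context: Conventions: $\mathbb{N}=\{1,2,\dots\}$, $\mathbb{N}_0=\mathbb{N}\cup\{0\}$, $\overline{\mathbb{R}}=\mathbb{R}\cup\{-\infty,+\infty\}$, with $+\infty-\infty=-\infty+\infty=+\infty$ and $0\cdot(+\infty)=0\cdot(-\infty)=0$. Inequalities between functions and limits of functions are pointwise. Setting: $\mathscr{X}$ is a finite non-empty set (state space). A situation is a finite string $x_{1:n}=(x_1,\dots,x_n)\in\mathscr{X}^n$, $n\in\mathbb{N}_0$ (the empty string is denoted $\Box$); $\mathscr{X}^*$ is the set of all situations. $\Omega=\mathscr{X}^{\mathbb{N}}$ is the set of paths $\omega=\omega_1\omega_2\cdots$, and $\omega^n=(\omega_1,\dots,\omega_n)$. For $s=x_{1:n}$, $\Gamma(s)=\{\omega\in\Omega:\omega^n=x_{1:n}\}$ (cylinder event) and $\mathbb{I}_s$ is the indicator of $\Gamma(s)$. $\overline{\mathbb{V}}$ is the set of all maps $\Omega\to\overline{\mathbb{R}}$ (global variables) and $\overline{\mathbb{V}}_{\mathrm b}$ the set of those that are bounded below by a real. A gamble is a bounded real-valued function. $f\in\overline{\mathbb{V}}$ is $n$-measurable if $f(\omega)$ depends only on $\omega^n$; it is finitary if it is $n$-measurable for some $n\in\mathbb{N}_0$. $\mathbb{V}_{\mathrm{fin}}$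 is the set of finitary gambles on $\Omega$. A sequence $\{f_n\}$ is uniformly bounded below if there is a real $c$ with $f_n\geq c$ for all $n$. $\mathscr{L}(\mathscr{X})$ is the set of all real-valued functions on $\mathscr{X}$; for $f\in\mathscr{L}(\mathscr{X})$, $f(X_{n+1})$ is the global variable $\omega\mapsto f(\omega_{n+1})$. Local models: an upper expectation $\overline{\mathrm{Q}}_s:\mathscr{L}(\mathscr{X})\to\overline{\mathbb{R}}$ is coherent if, for all $f,g\in\mathscr{L}(\mathscr{X})$ and real $\lambda\geq0$: $\overline{\mathrm{Q}}_s(f)\leq\sup f$; $\overline{\mathrm{Q}}_s(f+g)\leq\overline{\mathrm{Q}}_s(f)+\overline{\mathrm{Q}}_s(g)$; $\overline{\mathrm{Q}}_s(\lambda f)=\lambda\overline{\mathrm{Q}}_s(f)$ (it is then real-valued). An imprecise probability tree $\overline{\mathrm{Q}}$ assigns to each $s\in\mathscr{X}^*$ a coherent upper expectation $\overline{\mathrm{Q}}_s$ on $\mathscr{L}(\mathscr{X})$. Let $\mathbb{P}_s$ be the set of all probability mass functions $q$ on $\mathscr{X}$ with $\sum_{x\in\mathscr{X}}f(x)q(x)\leq\overline{\mathrm{Q}}_s(f)$ for all $f\in\mathscr{L}(\mathscr{X})$; it is known that $\overline{\mathrm{Q}}_s(f)=\max\{\sum_{x}f(x)q(x):q\in\mathbb{P}_s\}$. A global upper expectation is any map $\overline{\mathrm{E}}:\overline{\mathbb{V}}\times\mathscr{X}^*\to\overline{\mathbb{R}}$, $(f,s)\mapsto\overline{\mathrm{E}}(f\vert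 s)$; $\overline{\mathrm{E}}(f\vert X_{1:n})$ denotes the global variable $\omega\mapsto\overline{\mathrm{E}}(f\vert\omega^n)$. Axioms: P1: $\overline{\mathrm{E}}(f(X_{n+1})\vert x_{1:n})=\overline{\mathrm{Q}}_{x_{1:n}}(f)$ for all $f\in\mathscr{L}(\mathscr{X})$, $x_{1:n}\in\mathscr{X}^*$. P2: $\overline{\mathrm{E}}(f\vert s)=\overline{\mathrm{E}}(f\,\mathbb{I}_s\vert s)$ for all $f\in\mathbb{V}_{\mathrm{fin}}$, $s\in\mathscr{X}^*$. P3: $\overline{\mathrm{E}}(f\vert X_{1:n})\leq\overline{\mathrm{E}}(\overline{\mathrm{E}}(f\vert X_{1:n+1})\vert X_{1:n})$ for all $f\in\mathbb{V}_{\mathrm{fin}}$, $n\in\mathbb{N}_0$. P4: $f\leq g\Rightarrow\overline{\mathrm{E}}(f\vert s)\leq\overline{\mathrm{E}}(g\vert s)$ for all $f,g\in\overline{\mathbb{V}}$, $s\in\mathscr{X}^*$. P5: for any sequence $\{f_n\}_{n\in\mathbb{N}_0}$ of finitary gambles that is uniformly bounded below and any $s\in\mathscr{X}^*$, if $\lim_{n}f_n=f$ pointwise then $\limsup_{n}\overline{\mathrm{E}}(f_n\vert s)\geq\overline{\mathrm{E}}(f\vert s)$. $\overline{\mathbb{E}}_{1-5}(\overline{\mathrm{Q}})$ is the set of all global upper expectations satisfying P1–P5. Measure-theoretic model: a precise probability tree $p$ assigns to each $s\in\mathscr{X}^*$ a probability mass function $p(\cdot\vert s)$ on $\mathscr{X}$;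 it is compatible with $\overline{\mathrm{Q}}$, written $p\sim\overline{\mathrm{Q}}$, if $p(\cdot\vert s)\in\mathbb{P}_s$ for all $s\in\mathscr{X}^*$. Let $\mathscr{F}$ be the $\sigma$-algebra on $\Omega$ generated by all cylinder events. For each $x_{1:n}\in\mathscr{X}^*$, $\mathrm{P}(\cdot\vert x_{1:n})$ is the unique $\sigma$-additive probability measure on $\mathscr{F}$ such that, for all $z_{1:m}\in\mathscr{X}^*$, $\mathrm{P}(\Gamma(z_{1:m})\vert x_{1:n})$ equals $\prod_{i=n}^{m-1}p(z_{i+1}\vert z_{1:i})$ if $n<m$ and $z_{1:n}=x_{1:n}$; $1$ if $n\geq m$ and $z_{1:m}=x_{1:m}$; and $0$ otherwise. For $\mathscr{F}$-measurable $g\in\overline{\mathbb{V}}_{\mathrm b}$, $\mathrm{E}_{\mathrm{meas},p}(g\vert s)=\int_\Omega g\,\mathrm{d}\mathrm{P}(\cdot\vert s)$ (Lebesgue integral, which exists). For all $f\in\overline{\mathbb{V}}$ and $s\in\mathscr{X}^*$, $\overline{\mathrm{E}}_{\mathrm{meas},p}(f\vert s)=\inf\{\mathrm{E}_{\mathrm{meas},p}(g\vert s):g\in\overline{\mathbb{V}}_{\mathrm b},\ g\text{ is }\mathscr{F}\text{-measurable and }g\geq f\}$, and the global measure-theoretic upper expectation is $\overline{\mathrm{E}}_{\mathrm{meas}}(f\vert s)=\sup\{\overline{\mathrm{E}}_{\mathrm{meas},p}(f\vert s):p\sim\overline{\mathrm{Q}}\}$. *)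

theory Defs
  imports "HOL-Probability.Probability"
begin

text \<open>
  The state space is a type of class \<open>finite\<close>. Situations are lists of states; a path is a
  function \<open>\<omega> :: nat \<Rightarrow> 'a\<close>, and the state at time \<open>k + 1\<close> is \<open>\<omega> k\<close> (times start at 1).
  On \<open>ereal\<close>, the library has \<open>\<infinity> + (-\<infinity>) = \<infinity>\<close> and \<open>0 * (\<plusminus>\<infinity>) = 0\<close>, as required here.
\<close>

type_synonym 'a path = "nat \<Rightarrow> 'a"
type_synonym 'a situation = "'a list"
type_synonym 'a gvar = "'a path \<Rightarrow> ereal"
type_synonym 'a imprecise_tree = "'a situation \<Rightarrow> ('a \<Rightarrow> real) \<Rightarrow> ereal"
type_synonym 'a precise_tree = "'a situation \<Rightarrow> 'a pmf"
type_synonym 'a global_upper = "'a gvar \<Rightarrow> 'a situation \<Rightarrow> ereal"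

definition path_prefix :: "'a path \<Rightarrow> nat \<Rightarrow> 'a situation" where
  "path_prefix \<omega> n = map \<omega> [0..<n]"

definition cylinder :: "'a situation \<Rightarrow> 'a path set" where
  "cylinder s = {\<omega>. path_prefix \<omega> (length s) = s}"

definition bounded_below :: "'a gvar \<Rightarrow> bool" where
  "bounded_below f \<longleftrightarrow> (\<exists>c::real. \<forall>\<omega>. ereal c \<le> f \<omega>)"

definition n_measurable :: "nat \<Rightarrow> 'a gvar \<Rightarrow> bool" where
  "n_measurable n f \<longleftrightarrow> (\<forall>\<omega> \<omega>'. path_prefix \<omega> n = path_prefix \<omega>' n \<longrightarrow> f \<omega> = f \<omega>')"

definition finitary :: "'a gvar \<Rightarrow> bool" where
  "finitary f \<longleftrightarrow> (\<exists>n. n_measurable n f)"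

definition gamble :: "'a gvar \<Rightarrow> bool" where
  "gamble f \<longleftrightarrow> (\<exists>g :: 'a path \<Rightarrow> real. bounded (range g) \<and> f = (\<lambda>\<omega>. ereal (g \<omega>)))"

definition fin_gambles :: "'a gvar set" where
  "fin_gambles = {f. finitary f \<and> gamble f}"


subsection \<open>Local models\<close>

definition coherent :: "(('a::finite \<Rightarrow> real) \<Rightarrow> ereal) \<Rightarrow> bool" where
  "coherent q \<longleftrightarrow>
     (\<forall>f. q f \<le> (SUP x. ereal (f x))) \<and>
     (\<forall>f g. q (\<lambda>x. f x + g x) \<le> q f + q g) \<and>
     (\<forall>f (l::real). 0 \<le> l \<longrightarrow> q (\<lambda>x. l * f x) = ereal l * q f)"

definition imprecise_tree :: "'a::finite imprecise_tree \<Rightarrow> bool" where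
  "imprecise_tree Q \<longleftrightarrow> (\<forall>s. coherent (Q s))"

definition credal_set :: "'a::finite imprecise_tree \<Rightarrow> 'a situation \<Rightarrow> 'a pmf set" where
  "credal_set Q s = {q. \<forall>f. ereal (\<Sum>x\<in>UNIV. f x * pmf q x) \<le> Q s f}"

definition compatible :: "'a::finite precise_tree \<Rightarrow> 'a imprecise_tree \<Rightarrow> bool" where
  "compatible p Q \<longleftrightarrow> (\<forall>s. p s \<in> credal_set Q s)"


subsection \<open>The axioms\<close>

definition axiom_P1 :: "'a::finite imprecise_tree \<Rightarrow> 'a global_upper \<Rightarrow> bool" where
  "axiom_P1 Q E \<longleftrightarrow> (\<forall>f s. E (\<lambda>\<omega>. ereal (f (\<omega> (length s)))) s = Q s f)"

definition axiom_P2 :: "'a global_upper \<Rightarrow> bool" where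
  "axiom_P2 E \<longleftrightarrow>
     (\<forall>f\<in>fin_gambles. \<forall>s. E f s = E (\<lambda>\<omega>. f \<omega> * indicator (cylinder s) \<omega>) s)"

definition axiom_P3 :: "'a global_upper \<Rightarrow> bool" where
  "axiom_P3 E \<longleftrightarrow>
     (\<forall>f\<in>fin_gambles. \<forall>n. \<forall>\<omega>.
        E f (path_prefix \<omega> n) \<le> E (\<lambda>\<omega>'. E f (path_prefix \<omega>' (n + 1))) (path_prefix \<omega> n))"

definition axiom_P4 :: "'a global_upper \<Rightarrow> bool" where
  "axiom_P4 E \<longleftrightarrow> (\<forall>f g s. (\<forall>\<omega>. f \<omega> \<le> g \<omega>) \<longrightarrow> E f s \<le> E g s)"

definition axiom_P5 :: "'a global_upper \<Rightarrow> bool" where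
  "axiom_P5 E \<longleftrightarrow>
     (\<forall>(F :: nat \<Rightarrow> 'a gvar) f s.
        (\<forall>n. F n \<in> fin_gambles) \<and>
        (\<exists>c::real. \<forall>n \<omega>. ereal c \<le> F n \<omega>) \<and>
        (\<forall>\<omega>. (\<lambda>n. F n \<omega>) \<longlonglongrightarrow> f \<omega>)
        \<longrightarrow> limsup (\<lambda>n. E (F n) s) \<ge> E f s)"

definition upper_exps_1_5 :: "'a::finite imprecise_tree \<Rightarrow> 'a global_upper set" where
  "upper_exps_1_5 Q =
     {E. axiom_P1 Q E \<and> axiom_P2 E \<and> axiom_P3 E \<and> axiom_P4 E \<and> axiom_P5 E}"


subsection \<open>The measure-theoretic model\<close>

definition path_algebra :: "'a path measure" where
  "path_algebra = sigma UNIV (range cylinder)"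

definition cylinder_prob :: "'a precise_tree \<Rightarrow> 'a situation \<Rightarrow> 'a situation \<Rightarrow> real" where
  "cylinder_prob p x z =
     (if length x < length z \<and> take (length x) z = x
        then (\<Prod>i = length x..<length z. pmf (p (take i z)) (z ! i))
      else if length z \<le> length x \<and> z = take (length z) x then 1
      else 0)"

definition path_measure :: "'a precise_tree \<Rightarrow> 'a situation \<Rightarrow> 'a path measure" where
  "path_measure p x =
     (THE M. sets M = sets path_algebra \<and> prob_space M \<and>
             (\<forall>z. measure M (cylinder z) = cylinder_prob p x z))"

text \<open>
  The Lebesgue integral of an extended-real function is the integral of its positive part minus
  that of its negative part; \<open>e2ennreal\<close> truncates negative values to \<open>0\<close>. For a measurable
  function that is bounded below, the subtrahend is finite under a probability measure.
\<close>

definition ext_integral :: "'b measure \<Rightarrow> ('b \<Rightarrow> ereal) \<Rightarrow> ereal" where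
  "ext_integral M g =
     enn2ereal (\<integral>\<^sup>+\<omega>. e2ennreal (g \<omega>) \<partial>M) - enn2ereal (\<integral>\<^sup>+\<omega>. e2ennreal (- g \<omega>) \<partial>M)"

definition E_meas_precise :: "'a precise_tree \<Rightarrow> 'a global_upper" where
  "E_meas_precise p f s =
     Inf {ext_integral (path_measure p s) g | g.
            bounded_below g \<and> g \<in> borel_measurable path_algebra \<and> (\<forall>\<omega>. f \<omega> \<le> g \<omega>)}"

definition E_meas :: "'a::finite imprecise_tree \<Rightarrow> 'a global_upper" where
  "E_meas Q f s = Sup {E_meas_precise p f s | p. compatible p Q}"


subsection \<open>The definite description in \<open>path_measure\<close> is proper\<close>

lemma mem_cylinder: "\<omega> \<in> cylinder z \<longleftrightarrow> (\<forall>i<length z. \<omega> i = z ! i)"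
  unfolding cylinder_def path_prefix_def mem_Collect_eq list_eq_iff_nth_eq by simp

lemma cylinder_in_path_algebra: "cylinder z \<in> sets path_algebra"
  by (auto simp: path_algebra_def)

lemma path_measure_unique:
  assumes "sets M = sets path_algebra" "prob_space M" "\<And>z. measure M (cylinder z) = cylinder_prob p x z"
    and "sets N = sets path_algebra" "prob_space N" "\<And>z. measure N (cylinder z) = cylinder_prob p x z"
  shows "M = N"
proof (rule measure_eqI_generator_eq[where \<Omega> = UNIV and E = "insert {} (range cylinder)"
        and A = "\<lambda>_. UNIV"])
  interpret M: prob_space M by fact
  interpret N: prob_space N by fact
  have sub: "cylinder b \<subseteq> cylinder a"
    if "length a \<le> length b" and "\<omega> \<in> cylinder a" "\<omega> \<in> cylinder b" for a b :: "'a list" and \<omega>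
  proof
    fix \<omega>' assume *: "\<omega>' \<in> cylinder b"
    have "\<omega>' i = a ! i" if "i < length a" for i
      using * that \<open>length a \<le> length b\<close> \<open>\<omega> \<in> cylinder a\<close> \<open>\<omega> \<in> cylinder b\<close>
      by (simp add: mem_cylinder)
    then show "\<omega>' \<in> cylinder a" by (simp add: mem_cylinder)
  qed
  have Int: "cylinder a \<inter> cylinder b \<in> insert {} (range cylinder)" for a b :: "'a list"
  proof (cases "cylinder a \<inter> cylinder b = {}")
    case False
    then obtain \<omega> where w: "\<omega> \<in> cylinder a" "\<omega> \<in> cylinder b" by blast
    have "cylinder a \<inter> cylinder b = cylinder a \<or> cylinder a \<inter> cylinder b = cylinder b"
      using sub[of a b, OF _ w] sub[of b a, OF _ w(2) w(1)]
      by (cases "length a \<le> length b") (simp_all add: Int_absorb1 Int_absorb2)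
    then show ?thesis by (elim disjE) simp_all
  qed simp
  show "Int_stable (insert {} (range (cylinder :: 'a list \<Rightarrow> _)))"
  proof (rule Int_stableI)
    fix A B :: "'a path set"
    assume "A \<in> insert {} (range cylinder)" "B \<in> insert {} (range cylinder)"
    then show "A \<inter> B \<in> insert {} (range cylinder)"
      by (elim insertE rangeE) (simp_all only: Int Int_empty_left Int_empty_right insertI1)
  qed
  have eq: "sigma_sets UNIV (insert {} (range (cylinder :: 'a list \<Rightarrow> _))) = sigma_sets UNIV (range cylinder)"
    by (intro sigma_sets_eqI) (auto intro: sigma_sets.Empty)
  show "sets M = sigma_sets UNIV (insert {} (range cylinder))"
    "sets N = sigma_sets UNIV (insert {} (range cylinder))"
    unfolding eq using assms by (auto simp: path_algebra_def)
  have "cylinder [] = (UNIV :: 'a path set)" by (auto simp: mem_cylinder)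
  then show "range (\<lambda>_. UNIV) \<subseteq> insert {} (range (cylinder :: 'a list \<Rightarrow> _))" 
    by (auto intro: range_eqI[OF sym])
  show "emeasure M X = emeasure N X" if "X \<in> insert {} (range cylinder)" for X
    using that assms by (auto simp: M.emeasure_eq_measure N.emeasure_eq_measure)
  show "emeasure M UNIV \<noteq> \<infinity>" by (simp add: M.emeasure_eq_measure)
  show "insert {} (range (cylinder :: 'a list \<Rightarrow> _)) \<subseteq> Pow UNIV" by blast
  show "(\<Union>i::nat. UNIV) = (UNIV :: 'a path set)" by blast
qed

text \<open>
  For existence, draw \<open>c s\<close> from \<open>p s\<close> independently for every situation \<open>s\<close>; the path that follows
  \<open>x\<close> and afterwards moves from each situation \<open>s\<close> to \<open>c s\<close> has the required law.
\<close>

fun path_list_of_choice :: "'a list \<Rightarrow> ('a list \<Rightarrow> 'a) \<Rightarrow> nat \<Rightarrow> 'a list" where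
  "path_list_of_choice x c 0 = []"
| "path_list_of_choice x c (Suc n) = path_list_of_choice x c n @
     [if n < length x then x ! n else c (path_list_of_choice x c n)]"

definition path_of_choice :: "'a list \<Rightarrow> ('a list \<Rightarrow> 'a) \<Rightarrow> 'a path" where
  "path_of_choice x c n = (if n < length x then x ! n else c (path_list_of_choice x c n))"

lemma path_list_of_choice_eq: "path_list_of_choice x c n = path_prefix (path_of_choice x c) n"
proof (induction n)
  case (Suc n)
  have "path_list_of_choice x c (Suc n) = path_list_of_choice x c n @ [path_of_choice x c n]"
    by (simp add: path_of_choice_def)
  then show ?case by (simp only: Suc.IH) (simp add: path_prefix_def)
qed (simp add: path_prefix_def)

lemma path_of_choice_in_cylinder:
  "path_of_choice x c \<in> cylinder z \<longleftrightarrow> (\<forall>i<length z. (if i < length x then x ! i else c (take i z)) = z ! i)"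
proof -
  have 1: "(path_of_choice x c) i = z ! i \<longleftrightarrow> (if i < length x then x ! i else c (take i z)) = z ! i"
    if "i < length z" "\<forall>j<i. path_of_choice x c j = z ! j" for i
  proof -
    have "path_list_of_choice x c i = take i z"
      unfolding path_list_of_choice_eq path_prefix_def using that
      by (intro nth_equalityI) auto
    then show ?thesis by (simp add: path_of_choice_def)
  qed
  have "(if i < length x then x ! i else c (take i z)) = z ! i"
    if "\<forall>i<length z. path_of_choice x c i = z ! i" "i < length z" for i
    using 1[OF that(2)] that by simp
  moreover have "path_of_choice x c i = z ! i"
    if *: "\<forall>i<length z. (if i < length x then x ! i else c (take i z)) = z ! i"
      and "i < length z" for i
    using that(2)
  proof (induction i rule: less_induct)
    case (less i)
    have "\<forall>j<i. path_of_choice x c j = z ! j"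
      using less by simp
    with 1[OF less.prems] * less.prems show ?case by blast
  qed
  ultimately show ?thesis unfolding mem_cylinder by blast
qed

lemma path_measure_exists:
  fixes p :: "'a::finite precise_tree"
  shows "\<exists>M. sets M = sets path_algebra \<and> prob_space M \<and>
             (\<forall>z. measure M (cylinder z) = cylinder_prob p x z)"
proof -
  define C where "C = PiM (UNIV :: 'a list set) (\<lambda>s. measure_pmf (p s))"
  interpret product_prob_space "\<lambda>s. measure_pmf (p s)" "UNIV :: 'a list set" ..
  interpret C: prob_space C unfolding C_def by (rule prob_space_PiM) (rule prob_space_measure_pmf)
  define G where "G z = {c. path_of_choice x c \<in> cylinder z}" for z
  have G: "G z \<in> sets C \<and> measure C (G z) = cylinder_prob p x z" for z
  proof (cases "\<forall>i<min (length x) (length z). x ! i = z ! i")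
    case False
    then obtain i where i: "i < length x" "i < length z" "x ! i \<noteq> z ! i"
      by auto
    then have "G z = {}" unfolding G_def path_of_choice_in_cylinder by auto
    moreover have "cylinder_prob p x z = 0"
    proof -
      have "take (length x) z ! i \<noteq> x ! i" "z ! i \<noteq> take (length z) x ! i"
        using i by simp_all
      then have "take (length x) z \<noteq> x" "z \<noteq> take (length z) x"
        by metis+
      then show ?thesis by (simp add: cylinder_prob_def)
    qed
    ultimately show ?thesis by simp
  next
    case True
    define J where "J = (\<lambda>i. take i z) ` {length x..<length z}"
    have inj: "inj_on (\<lambda>i. take i z) {length x..<length z}"
    proof (rule inj_onI)
      fix i j assume ij: "i \<in> {length x..<length z}" "j \<in> {length x..<length z}"
        and "take i z = take j z"
      then have "length (take i z) = length (take j z)" by (simp only:)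
      with ij show "i = j" by simp
    qed
    define X where "X s = {z ! length s}" for s :: "'a list"
    have "(\<forall>i<length z. (if i < length x then x ! i else c (take i z)) = z ! i)
        \<longleftrightarrow> (\<forall>s\<in>J. c s \<in> X s)" for c
    proof -
      have "(\<forall>i<length z. (if i < length x then x ! i else c (take i z)) = z ! i)
          \<longleftrightarrow> (\<forall>i\<in>{length x..<length z}. c (take i z) = z ! i)"
        using True by (auto simp: Ball_def)
      then show ?thesis by (simp add: J_def X_def)
    qed
    then have "G z = {c \<in> space C. \<forall>s\<in>J. c s \<in> X s}"
      by (simp add: G_def path_of_choice_in_cylinder C_def space_PiM)
    moreover have "{c \<in> space C. \<forall>s\<in>J. c s \<in> X s} \<in> sets C"
      unfolding C_def J_def by measurable
    moreover have "measure C {c \<in> space C. \<forall>s\<in>J. c s \<in> X s} = (\<Prod>s\<in>J. measure (p s) (X s))"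
      unfolding C_def measure_def
      by (subst emeasure_PiM_Collect)
        (auto simp: J_def measure_pmf.emeasure_eq_measure prod_ennreal prod_nonneg)
    moreover have "(\<Prod>s\<in>J. measure (p s) (X s)) = (\<Prod>i = length x..<length z. pmf (p (take i z)) (z ! i))"
      unfolding J_def by (subst prod.reindex[OF inj]) (auto simp: X_def measure_pmf_single intro!: prod.cong)
    moreover have "cylinder_prob p x z = (\<Prod>i = length x..<length z. pmf (p (take i z)) (z ! i))"
    proof (cases "length x < length z")
      case l: True
      then have "take (length x) z = x" using True l by (intro nth_equalityI) auto
      then show ?thesis using l by (simp add: cylinder_prob_def)
    next
      case l: False
      then have "z = take (length z) x" using True l by (intro nth_equalityI) auto
      then show ?thesis using l by (simp add: cylinder_prob_def)
    qed
    ultimately show ?thesis by simp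
  qed
  have meas: "path_of_choice x \<in> measurable C path_algebra"
    unfolding path_algebra_def
  proof (rule measurable_measure_of)
    fix A :: "'a path set" assume "A \<in> range cylinder"
    then obtain z where "A = cylinder z" by auto
    then show "path_of_choice x -` A \<inter> space C \<in> sets C"
      using G[of z] by (auto simp: G_def vimage_def C_def space_PiM)
  qed auto
  have "measure (distr C path_algebra (path_of_choice x)) (cylinder z) = cylinder_prob p x z" for z
    using G[of z] by (subst measure_distr[OF meas cylinder_in_path_algebra])
      (auto simp: G_def vimage_def C_def space_PiM)
  then show ?thesis
    by (intro exI[of _ "distr C path_algebra (path_of_choice x)"]) (auto intro: C.prob_space_distr meas)
qed

lemma path_measure_ex1:
  fixes p :: "'a::finite precise_tree"
  shows "\<exists>!M. sets M = sets path_algebra \<and> prob_space M \<and>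
             (\<forall>z. measure M (cylinder z) = cylinder_prob p x z)"
  using path_measure_exists[of p x] path_measure_unique[where p = p and x = x] by blast

lemma path_measure:
  fixes p :: "'a::finite precise_tree"
  shows "sets (path_measure p x) = sets path_algebra" "prob_space (path_measure p x)"
    "measure (path_measure p x) (cylinder z) = cylinder_prob p x z"
  using theI'[OF path_measure_ex1[of p x]] unfolding path_measure_def by blast+

end

theory Submission
  imports Defs
begin

text \<open>
  On a measurable variable that is bounded below, the outer infimum that defines the upper integral
  of a precise tree is attained by the variable itself, so \<open>E_meas\<close> is there a supremum of ordinary
  integrals over the compatible trees. All variables that P1, P2, P3 and P5 evaluate are of this
  kind; P4 holds for arbitrary variables because the infimum ranges over fewer functions when the
  variable grows. The other axioms then reduce to facts about integrals.

  P2 holds because the measure conditional on \<open>s\<close> is concentrated on the cylinder of \<open>s\<close>.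

  P3 follows from the law of total probability for one step (\<open>integral_path_measure_step\<close>): for a
  compatible \<open>p\<close>, the integral given \<open>x\<close> is the \<open>p x\<close>-average of the integrals given \<open>x @ [a]\<close>.
  Replacing each of these by the upper expectation can only increase it, and the resulting average
  is itself the \<open>p\<close>-expectation of a variable that depends on one more state.

  P5 is Fatou's lemma (\<open>ext_integral_Fatou\<close>) for each fixed \<open>p\<close>, followed by the supremum
  over \<open>p\<close>: the limit inferior of a supremum is at least the supremum of the limits inferior.

  P1 says that the local model \<open>Q s f\<close> is the supremum of the expectations of \<open>f\<close> under the mass
  functions that \<open>Q s\<close> dominates. One inequality is the definition of the credal set. The other is a
  Hahn-Banach argument: a linear functional that supports the sublinear functional \<open>Q s\<close> at \<open>f\<close> is
  automatically given by a mass function (\<open>coherent_attained\<close>).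
\<close>

section \<open>Measurability of variables that depend on a finite prefix\<close>

lemma length_path_prefix [simp]: "length (path_prefix \<omega> n) = n"
  by (simp add: path_prefix_def)

lemma path_prefix_Suc: "path_prefix \<omega> (Suc n) = path_prefix \<omega> n @ [\<omega> n]"
  by (simp add: path_prefix_def)

lemma space_path_algebra [simp]: "space path_algebra = UNIV"
  by (simp add: path_algebra_def space_measure_of_conv)

lemma path_prefix_measurable [measurable]:
  "(\<lambda>\<omega> :: 'a::finite path. path_prefix \<omega> n) \<in> path_algebra \<rightarrow>\<^sub>M count_space UNIV"
proof (subst measurable_count_space_eq2_countable, intro conjI ballI)
  fix z :: "'a list"
  have "(\<lambda>\<omega>. path_prefix \<omega> n) -` {z} \<inter> space path_algebra
      = (if length z = n then cylinder z else {})"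
    by (auto simp: cylinder_def)
  then show "(\<lambda>\<omega>. path_prefix \<omega> n) -` {z} \<inter> space path_algebra \<in> sets path_algebra"
    by (simp add: cylinder_in_path_algebra)
qed auto

lemma finite_range_path_prefix: "finite (range (\<lambda>\<omega> :: 'a::finite path. path_prefix \<omega> n))"
  by (rule finite_subset[OF _ finite_lists_length_eq[of UNIV n]]) auto

lemma bounded_prefix_function:
  fixes g :: "'a::finite situation \<Rightarrow> real"
  shows "bounded (range (\<lambda>\<omega>. g (path_prefix \<omega> n)))"
proof -
  have "range (\<lambda>\<omega>. g (path_prefix \<omega> n)) = g ` range (\<lambda>\<omega>. path_prefix \<omega> n)"
    by auto
  then show ?thesis by (simp add: finite_imp_bounded finite_range_path_prefix)
qed

lemma prefix_function_measurable:
  fixes g :: "'a::finite situation \<Rightarrow> 'b::topological_space"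
  shows "(\<lambda>\<omega>. g (path_prefix \<omega> n)) \<in> borel_measurable path_algebra"
  by (rule measurable_compose[OF path_prefix_measurable]) simp

text \<open>
  With finitely many states, a variable that depends on a finite prefix factors through a countable
  discrete space of situations, which is why finitary gambles are measurable.
\<close>

lemma fin_gambleE:
  fixes f :: "'a::finite gvar"
  assumes "f \<in> fin_gambles"
  obtains h where "f = (\<lambda>\<omega>. ereal (h \<omega>))" "bounded (range h)" "h \<in> borel_measurable path_algebra"
proof -
  obtain h n where h: "f = (\<lambda>\<omega>. ereal (h \<omega>))" "bounded (range h)" and n: "n_measurable n f"
    using assms by (auto simp: fin_gambles_def gamble_def finitary_def)
  \<comment> \<open>By \<open>n\<close>-measurability, \<open>f\<close> takes the same value on all paths through \<open>z\<close>.\<close>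
  define path where "path z = (SOME \<omega> :: 'a path. path_prefix \<omega> n = z)" for z
  have "path_prefix (path (path_prefix \<omega> n)) n = path_prefix \<omega> n" for \<omega>
    unfolding path_def by (rule someI[of _ \<omega>]) (rule refl)
  then have "h = (\<lambda>\<omega>. h (path (path_prefix \<omega> n)))"
    using n unfolding h(1) n_measurable_def by (metis ereal.inject)
  moreover have "(\<lambda>\<omega>. h (path (path_prefix \<omega> n))) \<in> borel_measurable path_algebra"
    by (rule prefix_function_measurable)
  ultimately have "h \<in> borel_measurable path_algebra" by simp
  with h show thesis by (rule that)
qed


section \<open>The integral and the upper integral of a precise tree\<close>

lemma ext_integral_mono:
  assumes "\<And>\<omega>. f \<omega> \<le> g \<omega>"
  shows "ext_integral M f \<le> ext_integral M g"
  unfolding ext_integral_def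
  by (intro ereal_minus_mono) (auto simp: less_eq_ennreal.rep_eq[symmetric] assms intro!: nn_integral_mono e2ennreal_mono)

lemma ext_integral_ereal:
  assumes "integrable M h"
  shows "ext_integral M (\<lambda>\<omega>. ereal (h \<omega>)) = ereal (integral\<^sup>L M h)"
proof -
  have fin: "(\<integral>\<^sup>+\<omega>. ennreal (h \<omega>) \<partial>M) < \<infinity>" "(\<integral>\<^sup>+\<omega>. ennreal (- h \<omega>) \<partial>M) < \<infinity>"
    using assms by (auto simp: real_integrable_def less_top)
  have e: "enn2ereal a = ereal (enn2real a)" if "a < \<infinity>" for a
    using that by (cases a) (auto simp: enn2ereal_ennreal)
  show ?thesis
    using real_lebesgue_integral_def[OF assms] fin by (simp add: ext_integral_def e)
qed

context
  fixes p :: "'a::finite precise_tree" and s :: "'a situation"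
begin

interpretation prob_space "path_measure p s" by (rule path_measure)

lemma measurable_path_measure [simp]: "borel_measurable (path_measure p s) = borel_measurable path_algebra"
  by (rule measurable_cong_sets) (simp_all add: path_measure)

lemma space_path_measure [simp]: "space (path_measure p s) = UNIV"
  using sets_eq_imp_space_eq[OF path_measure(1)[of p s]] by simp

lemma emeasure_path_measure_UNIV: "emeasure (path_measure p s) UNIV = 1"
  using emeasure_space_1 by simp

lemma E_meas_precise_measurable:
  assumes "bounded_below f" "f \<in> borel_measurable path_algebra"
  shows "E_meas_precise p f s = ext_integral (path_measure p s) f"
  unfolding E_meas_precise_def
  using assms by (intro antisym Inf_lower Inf_greatest) (auto intro: ext_integral_mono)

lemma integrable_path_measure:
  fixes h :: "'a path \<Rightarrow> real"
  assumes "bounded (range h)" "h \<in> borel_measurable path_algebra"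
  shows "integrable (path_measure p s) h"
proof -
  obtain B where "\<forall>\<omega>. norm (h \<omega>) \<le> B" using assms(1) by (auto simp: bounded_iff)
  then show ?thesis using assms(2) by (intro integrable_const_bound[of _ B]) auto
qed

lemma E_meas_precise_real:
  assumes "bounded (range h)" "h \<in> borel_measurable path_algebra"
  shows "E_meas_precise p (\<lambda>\<omega>. ereal (h \<omega>)) s = ereal (integral\<^sup>L (path_measure p s) h)"
proof -
  obtain B where B: "\<forall>\<omega>. \<bar>h \<omega>\<bar> \<le> B" using assms(1) by (auto simp: bounded_iff)
  then have "bounded_below (\<lambda>\<omega>. ereal (h \<omega>))"
    unfolding bounded_below_def by (intro exI[of _ "-B"]) (auto simp: abs_le_iff minus_le_iff)
  then show ?thesis
    using assms by (simp add: E_meas_precise_measurable ext_integral_ereal integrable_path_measure)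
qed

lemma AE_cylinder: "AE \<omega> in path_measure p s. \<omega> \<in> cylinder s"
proof -
  have "prob (cylinder s) = 1"
    by (simp add: path_measure(3) cylinder_prob_def)
  then show ?thesis
    using AE_in_set_eq_1[of "cylinder s"] by (simp add: path_measure cylinder_in_path_algebra)
qed

text \<open>
  The positive part is handled by Fatou's lemma. The negative parts are bounded by a constant, so
  their integrals converge to a finite limit, and subtracting them preserves the inequality.
\<close>

lemma ext_integral_Fatou:
  assumes meas: "\<And>n. F n \<in> borel_measurable path_algebra"
    and lb: "\<And>n \<omega>. ereal c \<le> F n \<omega>" and lim: "\<And>\<omega>. (\<lambda>n. F n \<omega>) \<longlonglongrightarrow> f \<omega>"
  shows "ext_integral (path_measure p s) f \<le> liminf (\<lambda>n. ext_integral (path_measure p s) (F n))"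
proof -
  let ?M = "path_measure p s"
  define P N where "P g = (\<integral>\<^sup>+\<omega>. e2ennreal (g \<omega>) \<partial>?M)" and "N g = (\<integral>\<^sup>+\<omega>. e2ennreal (- g \<omega>) \<partial>?M)" for g
  have mF [measurable]: "F n \<in> borel_measurable ?M" for n using meas by simp
  have mf [measurable]: "f \<in> borel_measurable ?M"
    by (rule borel_measurable_LIMSEQ_order[where u = F]) (use lim mF in auto)
  have Np: "N g \<le> ennreal (- c)" if "\<And>\<omega>. ereal c \<le> g \<omega>" for g
  proof -
    have "N g \<le> (\<integral>\<^sup>+\<omega>. ennreal (- c) \<partial>?M)"
      unfolding N_def
    proof (rule nn_integral_mono)
      fix \<omega> show "e2ennreal (- g \<omega>) \<le> ennreal (- c)"
        using e2ennreal_mono[of "- g \<omega>" "ereal (- c)"] that[of \<omega>] 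
        by (metis e2ennreal_ereal ereal_minus_le_minus uminus_ereal.simps(1))
    qed
    then show ?thesis by (simp add: emeasure_path_measure_UNIV)
  qed
  have fc: "ereal c \<le> f \<omega>" for \<omega>
    by (rule LIMSEQ_le_const[OF lim]) (auto simp: lb)
  have "P f = (\<integral>\<^sup>+\<omega>. liminf (\<lambda>n. e2ennreal (F n \<omega>)) \<partial>?M)"
    unfolding P_def by (intro nn_integral_cong lim_imp_Liminf[symmetric] tendsto_e2ennrealI lim) simp
  also have "\<dots> \<le> liminf (\<lambda>n. P (F n))"
    unfolding P_def by (rule nn_integral_liminf) measurable
  finally have "enn2ereal (P f) \<le> enn2ereal (liminf (\<lambda>n. P (F n)))"
    by (simp add: less_eq_ennreal.rep_eq)
  also have "enn2ereal (liminf (\<lambda>n. P (F n))) = liminf (\<lambda>n. enn2ereal (P (F n)))"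
    by (rule Liminf_compose_continuous_mono[symmetric])
       (auto simp: continuous_on_enn2ereal mono_def less_eq_ennreal.rep_eq)
  finally have 1: "enn2ereal (P f) \<le> liminf (\<lambda>n. enn2ereal (P (F n)))" .
  have "(\<lambda>n. N (F n)) \<longlonglongrightarrow> N f"
    unfolding N_def
  proof (rule nn_integral_dominated_convergence[where w = "\<lambda>_. ennreal (- c)"])
    show "AE \<omega> in ?M. e2ennreal (- F n \<omega>) \<le> ennreal (- c)" for n
      using e2ennreal_mono[of "- F n _" "ereal (- c)"] lb
      by (metis (no_types, lifting) AE_I2 e2ennreal_ereal ereal_minus_le_minus uminus_ereal.simps(1))
    show "AE \<omega> in ?M. (\<lambda>n. e2ennreal (- F n \<omega>)) \<longlonglongrightarrow> e2ennreal (- f \<omega>)"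
      by (intro AE_I2 tendsto_e2ennrealI) (intro tendsto_intros lim)
  qed (use mF mf in \<open>simp_all add: emeasure_path_measure_UNIV del: measurable_path_measure\<close>)
  then have "(\<lambda>n. - enn2ereal (N (F n))) \<longlonglongrightarrow> - enn2ereal (N f)"
    by (intro tendsto_intros) 
  then have 2: "liminf (\<lambda>n. - enn2ereal (N (F n))) = - enn2ereal (N f)"
    by (intro lim_imp_Liminf) simp
  have "N f < \<infinity>" using Np[of f, OF fc] by (rule le_less_trans) simp
  then have 3: "\<bar>- enn2ereal (N f)\<bar> \<noteq> \<infinity>"
    by (cases "N f") (auto simp: enn2ereal_ennreal)
  have "enn2ereal (P f) - enn2ereal (N f)
      \<le> liminf (\<lambda>n. enn2ereal (P (F n))) + liminf (\<lambda>n. - enn2ereal (N (F n)))"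
    unfolding minus_ereal_def 2 by (intro add_mono 1 order_refl)
  also have "\<dots> \<le> liminf (\<lambda>n. enn2ereal (P (F n)) + - enn2ereal (N (F n)))"
    by (rule ereal_liminf_add_mono) (use 2 3 in \<open>fastforce simp del: ereal_uminus_eq_reorder\<close>)
  finally show ?thesis
    unfolding ext_integral_def P_def N_def minus_ereal_def .
qed

end


section \<open>One step of the tree\<close>

text \<open>
  For a situation \<open>z\<close> that extends \<open>x\<close> strictly, a single successor of \<open>x\<close> contributes, and it
  carries the first factor of the product for \<open>z\<close>. Otherwise \<open>z\<close> is compared with \<open>x\<close> alone, every
  successor gives the same value, and the mass function sums to one.
\<close>

lemma cylinder_prob_step:
  fixes p :: "'a::finite precise_tree"
  shows "(\<Sum>a\<in>UNIV. pmf (p x) a * cylinder_prob p (x @ [a]) z) = cylinder_prob p x z"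
proof (cases "length z \<le> length x")
  case True
  then show ?thesis
    by (simp add: cylinder_prob_def sum_pmf_eq_1 sum_distrib_right[symmetric])
next
  case False
  define n where "n = length x"
  have n: "n < length z" using False by (simp add: n_def)
  \<comment> \<open>The factors that are left after the step away from \<open>x\<close>.\<close>
  define R where "R = (\<Prod>i = Suc n..<length z. pmf (p (take i z)) (z ! i))"
  have "cylinder_prob p (x @ [a]) z = (if a = z ! n then if take n z = x then R else 0 else 0)" for a
  proof -
    have "take (Suc n) z = x @ [a] \<longleftrightarrow> take n z = x \<and> a = z ! n"
      using n by (auto simp: take_Suc_conv_app_nth)
    moreover have "z = x @ [a] \<longleftrightarrow> take n z = x \<and> a = z ! n" if "length z = Suc n"
      using calculation that by simp
    ultimately show ?thesis
      using n unfolding cylinder_prob_def R_def n_def[symmetric]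
      by (auto simp: n_def[symmetric] not_less le_Suc_eq)
  qed
  then have "(\<Sum>a\<in>UNIV. pmf (p x) a * cylinder_prob p (x @ [a]) z)
      = (if take n z = x then pmf (p x) (z ! n) * R else 0)"
    by (simp add: if_distrib[of "\<lambda>t. _ * t"] cong: if_cong)
  also have "\<dots> = cylinder_prob p x z"
    using n unfolding cylinder_prob_def n_def[symmetric] R_def
    by (auto simp: prod.atLeast_Suc_lessThan)
  finally show ?thesis .
qed

lemma path_measure_kernel:
  fixes p :: "'a::finite precise_tree"
  shows "(\<lambda>a. path_measure p (x @ [a])) \<in> measure_pmf q \<rightarrow>\<^sub>M subprob_algebra path_algebra"
  by (simp add: space_subprob_algebra path_measure prob_space_imp_subprob_space)

text \<open>
  Conditioning on \<open>x\<close> amounts to drawing the next state from \<open>p x\<close> and then conditioning on the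
  longer situation: both sides agree on cylinders by \<open>cylinder_prob_step\<close>, and these determine the
  measure.
\<close>

lemma path_measure_bind:
  fixes p :: "'a::finite precise_tree"
  shows "path_measure p x = measure_pmf (p x) \<bind> (\<lambda>a. path_measure p (x @ [a]))" (is "_ = ?N")
proof (rule path_measure_unique[of _ p x])
  show "sets ?N = sets path_algebra"
    by (rule sets_bind_measurable[OF path_measure_kernel]) simp
  show N: "prob_space ?N"
    by (rule measure_pmf.prob_space_bind[OF _ path_measure_kernel]) (simp add: path_measure)
  interpret N: prob_space ?N by (rule N)
  show "measure ?N (cylinder z) = cylinder_prob p x z" for z
  proof -
    have "measure ?N (cylinder z) = (\<integral>a. measure (path_measure p (x @ [a])) (cylinder z) \<partial>measure_pmf (p x))"
      by (rule measure_pmf.measure_bind[OF path_measure_kernel cylinder_in_path_algebra])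
    also have "\<dots> = (\<Sum>a\<in>UNIV. pmf (p x) a * cylinder_prob p (x @ [a]) z)"
      by (subst integral_measure_pmf[of UNIV]) (auto simp: path_measure)
    finally show ?thesis by (simp add: cylinder_prob_step)
  qed
qed (simp_all add: path_measure)

lemma integral_path_measure_step:
  fixes p :: "'a::finite precise_tree" and h :: "'a path \<Rightarrow> real"
  assumes "bounded (range h)" "h \<in> borel_measurable path_algebra"
  shows "integral\<^sup>L (path_measure p x) h
    = (\<Sum>a\<in>UNIV. pmf (p x) a * integral\<^sup>L (path_measure p (x @ [a])) h)"
proof -
  obtain B where B: "\<forall>\<omega>. \<bar>h \<omega>\<bar> \<le> B" using assms(1) by (auto simp: bounded_iff)
  have "integral\<^sup>L (path_measure p x) h
      = (\<integral>a. integral\<^sup>L (path_measure p (x @ [a])) h \<partial>measure_pmf (p x))"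
    unfolding path_measure_bind[of p x]
    by (rule integral_bind[OF assms(2) _ path_measure_kernel, where B' = 1 and B = B])
       (use B in \<open>auto simp: path_measure emeasure_path_measure_UNIV measure_pmf.finite_measure_axioms\<close>)
  then show ?thesis by (simp add: integral_measure_pmf[of UNIV])
qed

text \<open>
  Given \<open>x @ [a]\<close>, the prefix of the next length is almost surely \<open>x @ [a]\<close> itself. This evaluates
  both the local gambles of P1 and the outer expectation of P3.
\<close>

lemma integral_path_measure_next:
  fixes p :: "'a::finite precise_tree" and g :: "'a situation \<Rightarrow> real"
  shows "(\<integral>\<omega>. g (path_prefix \<omega> (Suc (length x))) \<partial>path_measure p x)
    = (\<Sum>a\<in>UNIV. pmf (p x) a * g (x @ [a]))"
proof -
  define h where "h \<omega> = g (path_prefix \<omega> (Suc (length x)))" for \<omega>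
  have b: "bounded (range h)" unfolding h_def by (rule bounded_prefix_function)
  have m: "h \<in> borel_measurable path_algebra" unfolding h_def by (rule prefix_function_measurable)
  have "integral\<^sup>L (path_measure p (x @ [a])) h = g (x @ [a])" for a
  proof -
    interpret prob_space "path_measure p (x @ [a])" by (rule path_measure)
    have "AE \<omega> in path_measure p (x @ [a]). h \<omega> = g (x @ [a])"
      using AE_cylinder[where s = "x @ [a]" and p = p]
      by eventually_elim (simp add: h_def cylinder_def)
    then have "integral\<^sup>L (path_measure p (x @ [a])) h
        = (\<integral>\<omega>. g (x @ [a]) \<partial>path_measure p (x @ [a]))"
      by (intro integral_cong_AE) (simp_all add: m)
    also have "\<dots> = g (x @ [a])" using prob_space by simp
    finally show ?thesis .
  qed
  then show ?thesis
    using integral_path_measure_step[OF b m, of p x] by (simp add: h_def[abs_def])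
qed


section \<open>Coherent upper expectations are upper envelopes\<close>

text \<open>
  A coherent upper expectation is real-valued: \<open>sup f\<close> bounds it above, and
  \<open>0 = q 0 \<le> q f + q (- f)\<close> with \<open>q (- f) < \<infinity>\<close> excludes the value \<open>-\<infinity>\<close>.
\<close>

lemma coherentE:
  fixes q :: "('a::finite \<Rightarrow> real) \<Rightarrow> ereal"
  assumes "coherent q"
  obtains r where "q = (\<lambda>f. ereal (r f))" "\<And>f c. (\<And>x. f x \<le> c) \<Longrightarrow> r f \<le> c"
    "\<And>f g. r (\<lambda>x. f x + g x) \<le> r f + r g" "\<And>f l. 0 \<le> l \<Longrightarrow> r (\<lambda>x. l * f x) = l * r f"
proof -
  have sup: "q f \<le> ereal c" if "\<And>x. f x \<le> c" for f c
  proof -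
    have "q f \<le> (SUP x. ereal (f x))" using assms unfolding coherent_def by blast
    also have "\<dots> \<le> ereal c" using that by (intro SUP_least) auto
    finally show ?thesis .
  qed
  have add: "q (\<lambda>x. f x + g x) \<le> q f + q g" for f g
    using assms unfolding coherent_def by blast
  have mul: "q (\<lambda>x. l * f x) = ereal l * q f" if "0 \<le> l" for l f
    using assms that unfolding coherent_def by blast
  have q0: "q (\<lambda>x. 0) = 0" using mul[of 0] by (simp flip: zero_ereal_def)
  have fin: "\<bar>q f\<bar> \<noteq> \<infinity>" for f
  proof -
    have "q f \<noteq> \<infinity>" for f
      using sup[of f "Max (range f)"] by auto
    moreover have "0 \<le> q f + q (\<lambda>x. - f x)" using add[of f "\<lambda>x. - f x"] by (simp add: q0)
    ultimately show ?thesis by (cases "q f"; cases "q (\<lambda>x. - f x)") auto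
  qed
  define r where "r f = real_of_ereal (q f)" for f
  have eq: "q f = ereal (r f)" for f using fin[of f] by (simp add: r_def ereal_real)
  show thesis
  proof
    show "q = (\<lambda>f. ereal (r f))" using eq by blast
    show "r f \<le> c" if "\<And>x. f x \<le> c" for f c
      using sup[OF that] by (simp add: eq)
    show "r (\<lambda>x. f x + g x) \<le> r f + r g" for f g
      using add[of f g] by (simp add: eq)
    show "r (\<lambda>x. l * f x) = l * r f" if "0 \<le> l" for f l
      using mul[OF that, of f] by (simp add: eq)
  qed
qed

text \<open>
  The Hahn-Banach theorem in finite dimension. A hyperplane that separates the strict epigraph of
  \<open>r\<close> from the point \<open>(f, r f)\<close> cannot be vertical, because the epigraph projects onto the whole
  space; it is therefore the graph of an affine function that touches \<open>r\<close> at \<open>f\<close> from below, and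
  homogeneity of \<open>r\<close> turns that into a linear one.
\<close>

lemma sublinear_dominates_supporting_linear:
  fixes r :: "('a::finite \<Rightarrow> real) \<Rightarrow> real"
  assumes add: "\<And>f g. r (\<lambda>x. f x + g x) \<le> r f + r g"
    and mul: "\<And>f l. 0 \<le> l \<Longrightarrow> r (\<lambda>x. l * f x) = l * r f"
  obtains w where "\<And>g. (\<Sum>x\<in>UNIV. g x * w x) \<le> r g" "(\<Sum>x\<in>UNIV. f x * w x) = r f"
proof -
  define S where "S = {(v :: real^'a, t). r (\<lambda>x. v $ x) < t}"
  define f' where "f' = (\<chi> x. f x)"
  have f': "($) f' = f" by (auto simp: f'_def)
  have "convex S"
  proof (rule convexI)
    fix y z and a b :: real
    assume "y \<in> S" "z \<in> S" and ab: "0 \<le> a" "0 \<le> b" "a + b = 1"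
    then obtain v t w u where y: "y = (v, t)" "r (\<lambda>x. v $ x) < t" and z: "z = (w, u)" "r (\<lambda>x. w $ x) < u"
      by (auto simp: S_def)
    have "r (\<lambda>x. a * v $ x + b * w $ x) \<le> a * r (\<lambda>x. v $ x) + b * r (\<lambda>x. w $ x)"
      using add[of "\<lambda>x. a * v $ x" "\<lambda>x. b * w $ x"] mul ab by simp
    also have "\<dots> < a * t + b * u"
    proof (cases "a = 0")
      case False
      then show ?thesis using ab y z by (intro add_less_le_mono mult_strict_left_mono mult_left_mono) auto
    qed (use ab z in auto)
    finally have "r (\<lambda>x. a * v $ x + b * w $ x) < a * t + b * u" .
    moreover have "($) (a *\<^sub>R v + b *\<^sub>R w) = (\<lambda>x. a * v $ x + b * w $ x)" by auto
    ultimately show "a *\<^sub>R y + b *\<^sub>R z \<in> S" by (simp add: y z S_def)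
  qed
  moreover have "convex {(f', r f)}" by simp
  moreover have "(f', r f + 1) \<in> S" by (simp add: S_def f')
  then have "S \<noteq> {}" by blast
  moreover have "S \<inter> {(f', r f)} = {}" by (simp add: S_def f')
  ultimately obtain A b where A: "A \<noteq> 0" "\<forall>y\<in>S. A \<bullet> y \<le> b" "A \<bullet> (f', r f) \<ge> b"
    using separating_hyperplane_sets[of S "{(f', r f)}"] by auto
  obtain u \<alpha> where Au: "A = (u, \<alpha>)" by (cases A)
  \<comment> \<open>The separating functional has a horizontal part \<open>u\<close> and a vertical part \<open>\<alpha>\<close>, and \<open>\<alpha> < 0\<close>
    because the epigraph is unbounded upwards and the hyperplane is not vertical.\<close>
  have sep: "u \<bullet> v + \<alpha> * t \<le> u \<bullet> f' + \<alpha> * r f" if "r (\<lambda>x. v $ x) < t" for v t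
    using A(2,3) that by (fastforce simp: S_def Au)
  have "\<alpha> \<le> 0" using sep[of f' "r f + 1"] by (simp add: f' algebra_simps)
  moreover have "\<alpha> \<noteq> 0"
  proof
    assume a: "\<alpha> = 0"
    have "u \<bullet> (f' + u) \<le> u \<bullet> f'"
      using sep[of "f' + u" "r (\<lambda>x. (f' + u) $ x) + 1"] by (simp add: a)
    then have "u \<bullet> u \<le> 0" by (simp add: inner_add_right)
    then have "u = 0" by (metis inner_eq_zero_iff inner_ge_zero order_antisym)
    then show False using A(1) a by (simp add: Au zero_prod_def)
  qed
  ultimately have neg: "\<alpha> < 0" by simp
  \<comment> \<open>Solving the equation of the hyperplane for its vertical coordinate gives slope \<open>u / - \<alpha>\<close>.\<close>
  define w where "w x = u $ x / - \<alpha>" for x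
  define L where "L g = (\<Sum>x\<in>UNIV. g x * w x)" for g
  have Lv: "L g * (- \<alpha>) = u \<bullet> (\<chi> x. g x)" for g
    unfolding L_def sum_distrib_right inner_vec_def
    by (intro sum.cong refl) (use neg in \<open>simp add: w_def\<close>)
  have 1: "L g - r g \<le> L f - r f" for g
  proof (rule field_le_epsilon)
    fix e :: real assume "0 < e"
    then have "u \<bullet> (\<chi> x. g x) + \<alpha> * (r g + e) \<le> u \<bullet> f' + \<alpha> * r f"
      by (intro sep) simp
    then have "(- \<alpha>) * (L g - r g) \<le> (- \<alpha>) * (L f - r f + e)"
      using Lv[of g] Lv[of f] by (simp add: f'_def algebra_simps)
    then show "L g - r g \<le> L f - r f + e" using neg by (simp only: mult_le_cancel_left_pos neg_0_less_iff_less)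
  qed
  have Lmul: "L (\<lambda>x. l * g x) = l * L g" for l g by (simp add: L_def sum_distrib_left mult.assoc)
  \<comment> \<open>If \<open>L\<close> exceeded \<open>r\<close> at \<open>g\<close>, it would do so by an arbitrarily large amount at multiples of \<open>g\<close>,
    against the bound above; the factor \<open>l\<close> is chosen to exceed that bound by one.\<close>
  have 2: "L g \<le> r g" for g
  proof (rule ccontr)
    assume "\<not> L g \<le> r g"
    then have pos: "0 < L g - r g" by simp
    define l where "l = (\<bar>L f - r f\<bar> + 1) / (L g - r g)"
    have "0 \<le> l" using pos by (simp add: l_def)
    then have "l * (L g - r g) \<le> L f - r f"
      using 1[of "\<lambda>x. l * g x"] by (simp add: Lmul mul algebra_simps)
    moreover have "l * (L g - r g) = \<bar>L f - r f\<bar> + 1" using pos by (simp add: l_def)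
    ultimately show False by simp
  qed
  \<comment> \<open>At the origin the same bound yields the opposite inequality at \<open>f\<close>.\<close>
  have "r (\<lambda>x. 0) = 0" using mul[of 0] by simp
  then have "0 \<le> L f - r f" using 1[of "\<lambda>x. 0"] by (simp add: L_def)
  with 2[of f] have "L f = r f" by simp
  with 2 show thesis by (intro that) (auto simp: L_def)
qed

text \<open>
  The supporting functional is an expectation because \<open>Q s g \<le> sup g\<close>: applied to minus the
  indicator of a state this makes the weights nonnegative, and applied to the constants \<open>1\<close> and \<open>-1\<close>
  it makes them sum to one.
\<close>

lemma coherent_attained:
  fixes Q :: "'a::finite imprecise_tree"
  assumes "imprecise_tree Q"
  obtains q where "q \<in> credal_set Q s" "ereal (\<Sum>x\<in>UNIV. f x * pmf q x) = Q s f"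
proof -
  obtain r where r: "Q s = (\<lambda>f. ereal (r f))" "\<And>f c. (\<And>x. f x \<le> c) \<Longrightarrow> r f \<le> c"
    "\<And>f g. r (\<lambda>x. f x + g x) \<le> r f + r g" "\<And>f l. 0 \<le> l \<Longrightarrow> r (\<lambda>x. l * f x) = l * r f"
    using coherentE[of "Q s"] assms by (auto simp: imprecise_tree_def)
  obtain w where w: "\<And>g. (\<Sum>x\<in>UNIV. g x * w x) \<le> r g" "(\<Sum>x\<in>UNIV. f x * w x) = r f"
    using sublinear_dominates_supporting_linear[of r f] r(3,4) by blast
  have nonneg: "0 \<le> w y" for y
  proof -
    have "(\<Sum>x\<in>UNIV. (if x = y then - 1 else 0) * w x) \<le> 0"
      by (rule order_trans[OF w(1) r(2)]) simp
    then show ?thesis by (simp add: if_distrib[of "\<lambda>t. t * _"] cong: if_cong)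
  qed
  have "(\<Sum>x\<in>UNIV. 1 * w x) \<le> 1" "(\<Sum>x\<in>UNIV. - 1 * w x) \<le> - 1"
    by (rule order_trans[OF w(1) r(2)], simp)+
  then have "(\<Sum>x\<in>UNIV. w x) = 1" by (simp add: sum_negf)
  then have "(\<integral>\<^sup>+x. ennreal (w x) \<partial>count_space UNIV) = 1"
    by (simp add: nn_integral_count_space_finite nonneg)
  then have "pmf (embed_pmf w) x = w x" for x by (intro pmf_embed_pmf nonneg)
  then show thesis
    using w by (intro that[of "embed_pmf w"]) (auto simp: credal_set_def r(1))
qed

text \<open>
  The credal sets of different situations can be chosen from independently, so a mass function that
  attains the local value at one situation extends to a compatible tree. In particular compatible
  trees exist, which keeps \<open>E_meas\<close> away from \<open>-\<infinity>\<close> on gambles.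
\<close>

lemma compatible_exists:
  assumes "imprecise_tree Q"
  obtains p where "compatible p Q" "ereal (\<Sum>x\<in>UNIV. f x * pmf (p s) x) = Q s f"
proof -
  have "\<exists>q. q \<in> credal_set Q s \<and> ereal (\<Sum>x\<in>UNIV. f x * pmf q x) = Q s f" for s
    by (rule coherent_attained[OF assms, of s f]) blast
  then obtain p where "\<forall>s. p s \<in> credal_set Q s \<and> ereal (\<Sum>x\<in>UNIV. f x * pmf (p s) x) = Q s f"
    by metis
  then show thesis by (intro that[of p]) (auto simp: compatible_def)
qed


section \<open>The axioms\<close>

lemma E_meas_upper: "compatible p Q \<Longrightarrow> E_meas_precise p f s \<le> E_meas Q f s"
  unfolding E_meas_def by (rule Sup_upper) auto

lemma E_meas_least: "(\<And>p. compatible p Q \<Longrightarrow> E_meas_precise p f s \<le> b) \<Longrightarrow> E_meas Q f s \<le> b"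
  unfolding E_meas_def by (rule Sup_least) auto

lemma E_meas_P1:
  assumes "imprecise_tree Q"
  shows "axiom_P1 Q (E_meas Q)"
  unfolding axiom_P1_def
proof (intro allI)
  fix f :: "'a \<Rightarrow> real" and s :: "'a situation"
  have "(\<lambda>\<omega>. ereal (f (\<omega> (length s)))) = (\<lambda>\<omega>. ereal (f (last (path_prefix \<omega> (Suc (length s))))))"
    by (simp add: path_prefix_Suc)
  then have val: "E_meas_precise p (\<lambda>\<omega>. ereal (f (\<omega> (length s)))) s = ereal (\<Sum>x\<in>UNIV. f x * pmf (p s) x)" for p
    using integral_path_measure_next[where g = "\<lambda>z. f (last z)" and x = s and p = p]
      and bounded_prefix_function[of "\<lambda>z. f (last z)"] prefix_function_measurable[of "\<lambda>z. f (last z)"]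
    by (simp add: E_meas_precise_real mult.commute)
  show "E_meas Q (\<lambda>\<omega>. ereal (f (\<omega> (length s)))) s = Q s f"
  proof (rule antisym)
    show "E_meas Q (\<lambda>\<omega>. ereal (f (\<omega> (length s)))) s \<le> Q s f"
      by (rule E_meas_least) (simp add: val compatible_def credal_set_def)
    obtain p where p: "compatible p Q" "ereal (\<Sum>x\<in>UNIV. f x * pmf (p s) x) = Q s f"
      using compatible_exists[OF assms] .
    show "Q s f \<le> E_meas Q (\<lambda>\<omega>. ereal (f (\<omega> (length s)))) s"
      using E_meas_upper[OF p(1), of "\<lambda>\<omega>. ereal (f (\<omega> (length s)))" s] by (simp only: val p(2))
  qed
qed

lemma E_meas_P2: "axiom_P2 (E_meas Q)"
  unfolding axiom_P2_def
proof (intro ballI allI)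
  fix f :: "'a gvar" and s :: "'a situation"
  assume "f \<in> fin_gambles"
  then obtain h where h: "f = (\<lambda>\<omega>. ereal (h \<omega>))" "bounded (range h)" "h \<in> borel_measurable path_algebra"
    by (rule fin_gambleE)
  define h' where "h' \<omega> = h \<omega> * indicator (cylinder s) \<omega>" for \<omega>
  have h': "(\<lambda>\<omega>. f \<omega> * indicator (cylinder s) \<omega>) = (\<lambda>\<omega>. ereal (h' \<omega>))"
    by (auto simp: h h'_def indicator_def)
  have b: "bounded (range h')"
    by (rule bounded_subset[of "insert 0 (range h)"]) (auto simp: h h'_def indicator_def)
  have m: "h' \<in> borel_measurable path_algebra"
    unfolding h'_def
    by (intro borel_measurable_times borel_measurable_indicator h(3) cylinder_in_path_algebra)
  have "integral\<^sup>L (path_measure p s) h = integral\<^sup>L (path_measure p s) h'" for p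
  proof (rule integral_cong_AE)
    show "AE \<omega> in path_measure p s. h \<omega> = h' \<omega>"
      using AE_cylinder[where s = s and p = p] by eventually_elim (simp add: h'_def)
  qed (use h m in auto)
  then have "E_meas_precise p f s = E_meas_precise p (\<lambda>\<omega>. f \<omega> * indicator (cylinder s) \<omega>) s" for p
    unfolding h' by (simp add: h E_meas_precise_real b m)
  then show "E_meas Q f s = E_meas Q (\<lambda>\<omega>. f \<omega> * indicator (cylinder s) \<omega>) s"
    unfolding E_meas_def by simp
qed

lemma E_meas_P3:
  assumes "imprecise_tree Q"
  shows "axiom_P3 (E_meas Q)"
  unfolding axiom_P3_def
proof (intro ballI allI)
  fix f :: "'a gvar" and n and \<omega> :: "'a path"
  assume "f \<in> fin_gambles"
  then obtain h where h: "f = (\<lambda>\<omega>. ereal (h \<omega>))" "bounded (range h)" "h \<in> borel_measurable path_algebra"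
    by (rule fin_gambleE)
  obtain B where B: "\<And>\<omega>. \<bar>h \<omega>\<bar> \<le> B" using h(2) by (auto simp: bounded_iff)
  define I where "I p s = integral\<^sup>L (path_measure p s) h" for p s
  have val: "E_meas_precise p f s = ereal (I p s)" for p s
    using h by (simp add: E_meas_precise_real I_def)
  have I: "\<bar>I p s\<bar> \<le> B" for p s
  proof -
    interpret prob_space "path_measure p s" by (rule path_measure)
    have "\<bar>I p s\<bar> \<le> (\<integral>\<omega>. \<bar>h \<omega>\<bar> \<partial>path_measure p s)" unfolding I_def by (rule integral_abs_bound)
    also have "\<dots> \<le> (\<integral>\<omega>. B \<partial>path_measure p s)"
      using integrable_path_measure[OF h(2,3)] B by (intro integral_mono) auto
    finally show ?thesis by (simp add: prob_space[simplified])
  qed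
  obtain p0 where p0: "compatible p0 Q" using compatible_exists[OF assms] .
  \<comment> \<open>\<open>E_meas\<close> of a gamble is finite, so its conditional version is again a real variable.\<close>
  define e where "e s = real_of_ereal (E_meas Q f s)" for s
  have e: "E_meas Q f s = ereal (e s)" for s
  proof -
    have "E_meas Q f s \<le> ereal B"
      using I by (intro E_meas_least) (auto simp: val abs_le_iff)
    moreover have "ereal (I p0 s) \<le> E_meas Q f s" using E_meas_upper[OF p0, of f s] by (simp add: val)
    ultimately have "\<bar>E_meas Q f s\<bar> \<noteq> \<infinity>" by auto
    then show ?thesis by (simp add: e_def ereal_real)
  qed
  have Ie: "I p s \<le> e s" if "compatible p Q" for p s
    using E_meas_upper[OF that, of f s] by (simp add: val e)
  define x where "x = path_prefix \<omega> n"
  have lx: "length x = n" by (simp add: x_def)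
  show "E_meas Q f (path_prefix \<omega> n) \<le> E_meas Q (\<lambda>\<omega>'. E_meas Q f (path_prefix \<omega>' (n + 1))) (path_prefix \<omega> n)"
    unfolding x_def[symmetric]
  proof (rule E_meas_least)
    fix p assume p: "compatible p Q"
    have "I p x = (\<Sum>a\<in>UNIV. pmf (p x) a * I p (x @ [a]))"
      unfolding I_def by (rule integral_path_measure_step[OF h(2,3)])
    also have "\<dots> \<le> (\<Sum>a\<in>UNIV. pmf (p x) a * e (x @ [a]))"
      by (intro sum_mono mult_left_mono Ie p) simp
    finally have "ereal (I p x) \<le> E_meas_precise p (\<lambda>\<omega>'. ereal (e (path_prefix \<omega>' (Suc n)))) x"
      using integral_path_measure_next[where g = e and x = x and p = p]
      by (simp add: E_meas_precise_real bounded_prefix_function prefix_function_measurable lx)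
    also have "\<dots> \<le> E_meas Q (\<lambda>\<omega>'. ereal (e (path_prefix \<omega>' (Suc n)))) x"
      by (rule E_meas_upper[OF p])
    finally show "E_meas_precise p f x \<le> E_meas Q (\<lambda>\<omega>'. E_meas Q f (path_prefix \<omega>' (n + 1))) x"
      by (simp add: val e)
  qed
qed

lemma E_meas_P4: "axiom_P4 (E_meas Q)"
  unfolding axiom_P4_def
proof (intro allI impI)
  fix f g :: "'a gvar" and s
  assume "\<forall>\<omega>. f \<omega> \<le> g \<omega>"
  then have "E_meas_precise p f s \<le> E_meas_precise p g s" for p
    unfolding E_meas_precise_def by (intro Inf_superset_mono) (auto intro: order_trans)
  then show "E_meas Q f s \<le> E_meas Q g s"
    by (intro E_meas_least) (auto intro: order_trans E_meas_upper)
qed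

lemma E_meas_P5: "axiom_P5 (E_meas Q)"
  unfolding axiom_P5_def
proof (intro allI impI, elim conjE exE)
  fix F :: "nat \<Rightarrow> 'a gvar" and f s and c :: real
  assume F: "\<forall>n. F n \<in> fin_gambles" and c: "\<forall>n \<omega>. ereal c \<le> F n \<omega>"
    and lim: "\<forall>\<omega>. (\<lambda>n. F n \<omega>) \<longlonglongrightarrow> f \<omega>"
  have m: "F n \<in> borel_measurable path_algebra" for n
    using F fin_gambleE[of "F n"] by (metis borel_measurable_ereal)
  have mf: "f \<in> borel_measurable path_algebra"
    by (rule borel_measurable_LIMSEQ_order[where u = F]) (use lim m in auto)
  have bF: "bounded_below (F n)" for n using c by (auto simp: bounded_below_def)
  have "ereal c \<le> f \<omega>" for \<omega> using lim c by (intro LIMSEQ_le_const[of "\<lambda>n. F n \<omega>"]) auto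
  then have bf: "bounded_below f" by (auto simp: bounded_below_def)
  show "E_meas Q f s \<le> limsup (\<lambda>n. E_meas Q (F n) s)"
  proof (rule E_meas_least)
    fix p assume p: "compatible p Q"
    have "E_meas_precise p f s \<le> liminf (\<lambda>n. E_meas_precise p (F n) s)"
      using ext_integral_Fatou[where F = F and c = c and f = f and p = p and s = s] m c lim
      by (simp add: E_meas_precise_measurable mf bf bF)
    also have "\<dots> \<le> liminf (\<lambda>n. E_meas Q (F n) s)"
      by (intro Liminf_mono always_eventually allI E_meas_upper p)
    also have "\<dots> \<le> limsup (\<lambda>n. E_meas Q (F n) s)" by (rule Liminf_le_Limsup) simp
    finally show "E_meas_precise p f s \<le> limsup (\<lambda>n. E_meas Q (F n) s)" .
  qed
qed

theorem theorem18:
  fixes Q :: "'a::finite imprecise_tree"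
  assumes "imprecise_tree Q"
  shows "E_meas Q \<in> upper_exps_1_5 Q"
  using assms
  by (simp add: upper_exps_1_5_def E_meas_P1 E_meas_P2 E_meas_P3 E_meas_P4 E_meas_P5)

end
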